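(* Let $G$ be an infinite finitely generated group and let $\alpha$ be an action of $G$ on a set $X$ such that $\mathsf{F}_\alpha(L)<\infty$ for all $L\in\mathcal{L}_G$. Then, as formal power series, the dynamical zeta function of $\alpha$ is given by the product \[ \zeta_\alpha(z)=\prod_{Y}\prod_{n\geqslant 1}(1-z^{|Y|n})^{-b_{L(Y)}(n)}, \] where $Y$ runs over all finite orbits of $\alpha$ in $X$, $L(Y)$ is the stabilizer of any element of $Y$, and the exponents $b_{L(Y)}(n)\in\mathbb{Q}$, $n\geqslant 1$, are the coefficients of the Dirichlet series $\Delta_{L(Y)}(z)=\sum_{n\geqslant 1}b_{L(Y)}(n)n^{-z}$. Hence, if $\Delta_L$ has integer coefficients for all $L\in\mathcal{L}_G$, then the formal power series for $\zeta_\alpha$ has integer coefficients.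
   Context: For a finitely generated group $G$, $\mathcal{L}_G$ denotes the set of finite index subgroups of $G$, $[L]=[G:L]$ for $L\in\mathcal{L}_G$, $\mathcal{L}_G(n)$ is the (finite) set of subgroups of index $n$, and $a_G(n)=|\mathcal{L}_G(n)|$. For a $G$-action $\alpha$ on a set $X$ and $L\in\mathcal{L}_G$, $\mathsf{F}_\alpha(L)$ is the cardinality of $\{x\in X: gx=x\text{ for all }g\in L\}$. The dynamical zeta function of $\alpha$ is the formal power series \[ \zeta_\alpha(z)=\exp\sum_{L\in\mathcal{L}_G}\frac{\mathsf{F}_\alpha(L)}{[L]}z^{[L]}=\exp\sum_{n\geqslant 1}\frac1n\sum_{L\in\mathcal{L}_G(n)}\mathsf{F}_\alpha(L)z^n . \] The zeta function of a finitely generated group $L$ is the formal Dirichlet series $\zeta_L(z)=\sum_{n\geqslant 1}a_L(n)n^{-z}$, where $a_L(n)$ is the number of subgroups of index $n$ in $L$. With $\zeta$ the Riemann zeta function, $\Delta_L$ is the formal Dirichlet series \[ \Delta_L(z)=\frac{\zeta_L(z+1)}{\zeta(z+1)}=\sum_{n\geqslant 1}\frac{b_L(n)}{n^z}, \] which has rational coefficients $b_L(n)$. For $b\in\mathbb{Q}$ and $m\geqslant 1$, $(1-z^m)^{-b}$ is the formal power series $\exp(-b\log(1-z^m))$. Stabilizers of elements in the same orbit are conjugate, so $b_{L(Y)}(n)$ does not depend on the chosen element of $Y$. *)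

theory Defs
  imports
    "HOL-Algebra.Group_Action"
    "HOL-Algebra.Generated_Groups"
    "HOL-Computational_Algebra.Formal_Power_Series"
begin

definition finitely_generated :: "('a, 'c) monoid_scheme \<Rightarrow> bool" where
  "finitely_generated G \<longleftrightarrow> (\<exists>S. finite S \<and> S \<subseteq> carrier G \<and> generate G S = carrier G)"

definition finite_index_subgroups :: "('a, 'c) monoid_scheme \<Rightarrow> 'a set set" where
  "finite_index_subgroups G = {L. subgroup L G \<and> finite (rcosets\<^bsub>G\<^esub> L)}"

definition subgroup_index :: "('a, 'c) monoid_scheme \<Rightarrow> 'a set \<Rightarrow> nat" where
  "subgroup_index G L = card (rcosets\<^bsub>G\<^esub> L)"

definition subgroups_of_index :: "('a, 'c) monoid_scheme \<Rightarrow> nat \<Rightarrow> 'a set set" where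
  "subgroups_of_index G n = {L \<in> finite_index_subgroups G. subgroup_index G L = n}"


section \<open>Formal Dirichlet series\<close>

text \<open>
  The formal Dirichlet series with terms \<open>f n * n powr (- z)\<close>, for \<open>n \<ge> 1\<close>, is
  represented by its coefficient function \<open>f\<close>. The value \<open>f 0\<close> has no meaning.
\<close>

definition dirichlet_mult :: "(nat \<Rightarrow> 'a) \<Rightarrow> (nat \<Rightarrow> 'a) \<Rightarrow> nat \<Rightarrow> 'a::field" where
  "dirichlet_mult f g n = (if n = 0 then 0 else \<Sum>d | d dvd n. f d * g (n div d))"

text \<open>
  The quotient of \<open>f\<close> by \<open>g\<close> (where \<open>g 1 \<noteq> 0\<close>), obtained by solving
  \<open>dirichlet_mult q g = f\<close> recursively for \<open>q\<close>; see \<open>dirichlet_mult_divide\<close> below.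
\<close>

function dirichlet_divide :: "(nat \<Rightarrow> 'a) \<Rightarrow> (nat \<Rightarrow> 'a) \<Rightarrow> nat \<Rightarrow> 'a::field" where
  "dirichlet_divide f g n =
     (if n = 0 then 0
      else (f n - (\<Sum>d | d dvd n \<and> d < n. dirichlet_divide f g d * g (n div d))) / g 1)"
  by auto
termination by (relation "measure (\<lambda>(f, g, n). n)") auto

declare dirichlet_divide.simps [simp del]

lemma dirichlet_mult_divide:
  assumes "g 1 \<noteq> 0" and "n > 0"
  shows "dirichlet_mult (dirichlet_divide f g) g n = f n"
proof -
  have "{d. d dvd n} = insert n {d. d dvd n \<and> d < n}"
    using assms(2) by (auto dest: dvd_imp_le)
  moreover have "finite {d. d dvd n \<and> d < n}"
    by simp
  ultimately have "dirichlet_mult (dirichlet_divide f g) g n =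
      dirichlet_divide f g n * g (n div n) +
      (\<Sum>d | d dvd n \<and> d < n. dirichlet_divide f g d * g (n div d))"
    using assms(2) by (simp add: dirichlet_mult_def)
  moreover have "dirichlet_divide f g n * g 1 =
      f n - (\<Sum>d | d dvd n \<and> d < n. dirichlet_divide f g d * g (n div d))"
    using assms by (subst dirichlet_divide.simps) simp
  ultimately show ?thesis
    using assms(2) by simp
qed

text \<open>The substitution \<open>z \<mapsto> z + 1\<close>.\<close>

definition dirichlet_shift :: "(nat \<Rightarrow> 'a) \<Rightarrow> nat \<Rightarrow> 'a::field" where
  "dirichlet_shift f n = f n / of_nat n"

definition riemann_zeta :: "nat \<Rightarrow> rat" where
  "riemann_zeta n = (if n = 0 then 0 else 1)"

definition group_zeta :: "('a, 'c) monoid_scheme \<Rightarrow> nat \<Rightarrow> rat" where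
  "group_zeta G n = of_nat (card (subgroups_of_index G n))"

definition group_Delta :: "('a, 'c) monoid_scheme \<Rightarrow> nat \<Rightarrow> rat" where
  "group_Delta G = dirichlet_divide (dirichlet_shift (group_zeta G)) (dirichlet_shift riemann_zeta)"


section \<open>Formal power series\<close>

text \<open>
  \<open>(1 - z ^ m)\<close> to the power \<open>c\<close>, for \<open>m \<ge> 1\<close>. Note that \<open>fps_ln 1\<close> is the series of
  \<open>log (1 + z)\<close> and \<open>fps_exp 1\<close> that of \<open>exp z\<close>.
\<close>

definition fps_one_minus_powr :: "nat \<Rightarrow> rat \<Rightarrow> rat fps" where
  "fps_one_minus_powr m c = fps_exp 1 oo (fps_const c * (fps_ln 1 oo (- (fps_X ^ m))))"

text \<open>
  Unordered products over arbitrary index sets, as limits of the finite subproducts. The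
  library metric on formal power series is the \<open>X\<close>-adic one, so that convergence means that
  each coefficient is eventually constant.
\<close>

definition fps_has_prod :: "('i \<Rightarrow> rat fps) \<Rightarrow> 'i set \<Rightarrow> rat fps \<Rightarrow> bool" where
  "fps_has_prod f A p \<longleftrightarrow> ((\<lambda>S. \<Prod>i\<in>S. f i) \<longlongrightarrow> p) (finite_subsets_at_top A)"

definition fps_prodable :: "('i \<Rightarrow> rat fps) \<Rightarrow> 'i set \<Rightarrow> bool" where
  "fps_prodable f A \<longleftrightarrow> (\<exists>p. fps_has_prod f A p)"

definition fps_prodinf :: "('i \<Rightarrow> rat fps) \<Rightarrow> 'i set \<Rightarrow> rat fps" where
  "fps_prodinf f A = Lim (finite_subsets_at_top A) (\<lambda>S. \<Prod>i\<in>S. f i)"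


section \<open>Group actions\<close>

definition fixed_points :: "'x set \<Rightarrow> ('a \<Rightarrow> 'x \<Rightarrow> 'x) \<Rightarrow> 'a set \<Rightarrow> 'x set" where
  "fixed_points X \<alpha> L = {x \<in> X. \<forall>g\<in>L. \<alpha> g x = x}"

definition dynamical_zeta ::
    "('a, 'c) monoid_scheme \<Rightarrow> 'x set \<Rightarrow> ('a \<Rightarrow> 'x \<Rightarrow> 'x) \<Rightarrow> rat fps" where
  "dynamical_zeta G X \<alpha> = fps_exp 1 oo
     Abs_fps (\<lambda>n. if n = 0 then 0
       else 1 / of_nat n * (\<Sum>L\<in>subgroups_of_index G n. of_nat (card (fixed_points X \<alpha> L))))"

definition finite_orbits ::
    "('a, 'c) monoid_scheme \<Rightarrow> 'x set \<Rightarrow> ('a \<Rightarrow> 'x \<Rightarrow> 'x) \<Rightarrow> 'x set set" where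
  "finite_orbits G X \<alpha> = {Y \<in> orbits G X \<alpha>. finite Y}"

text \<open>The exponents \<open>b\<^sub>L(n)\<close> for a subgroup \<open>L\<close> of \<open>G\<close>, regarded as a group itself.\<close>

definition b_coeff :: "('a, 'c) monoid_scheme \<Rightarrow> 'a set \<Rightarrow> nat \<Rightarrow> rat" where
  "b_coeff G L n = group_Delta (G\<lparr>carrier := L\<rparr>) n"

text \<open>
  The factor contributed by \<open>Y\<close> and \<open>n\<close>, with the stabilizer taken at the point \<open>y\<close> of \<open>Y\<close>.
\<close>

definition orbit_factor ::
    "('a, 'c) monoid_scheme \<Rightarrow> ('a \<Rightarrow> 'x \<Rightarrow> 'x) \<Rightarrow> 'x set \<Rightarrow> 'x \<Rightarrow> nat \<Rightarrow> rat fps" where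
  "orbit_factor G \<alpha> Y y n =
     fps_one_minus_powr (card Y * n) (- b_coeff G (stabilizer G \<alpha> y) n)"

end

theory Submission
  imports Defs
begin

text \<open>
  Taking logarithms turns both sides into sums. Count the pairs \<open>(L, x)\<close> with
  \<open>[G : L] = n\<close> and \<open>L\<close> fixing \<open>x\<close> by orbits: such an \<open>x\<close> lies in an orbit \<open>Y\<close> whose size
  divides \<open>n\<close>, and \<open>L\<close> is a subgroup of index \<open>n / |Y|\<close> of the stabilizer of \<open>x\<close>. Hence \<open>Y\<close>
  contributes \<open>\<Sum>m. a m / m * z ^ (|Y| * m)\<close> to \<open>log \<zeta>\<close>, where \<open>a m\<close> is the number of
  subgroups of index \<open>m\<close> in \<open>L(Y)\<close>. By definition of \<open>\<Delta>\<close>,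
  \<open>a m / m = \<Sum>d dvd m. b d * d / m\<close>, which rearranges the contribution into
  \<open>\<Sum>d. - b d * log (1 - z ^ (|Y| * d))\<close>.
\<close>

section \<open>Exponentials and infinite products of formal power series\<close>

text \<open>The \<open>n\<close>-th coefficient of a composition combines the \<open>n\<close>-th
  coefficients of the powers of the inner series, and these see only its coefficients up to
  \<open>n\<close>. This carries agreement of truncated logarithms over to their
  exponentials.\<close>

lemma fps_nth_compose_cong:
  assumes "\<And>j. j \<le> n \<Longrightarrow> fps_nth g j = fps_nth h j"
  shows "fps_nth (f oo g) n = fps_nth (f oo h) n"
proof -
  have "\<forall>j\<le>n. fps_nth (g ^ i) j = fps_nth (h ^ i) j" for i
  proof (induction i)
    case (Suc i)
    then show ?case
      using assms by (auto simp: fps_mult_nth intro!: sum.cong)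
  qed simp
  then show ?thesis
    by (simp add: fps_compose_nth)
qed

text \<open>Uniqueness for the linear equation y' = h y: comparing coefficients at \<open>m\<close>
  determines coefficient \<open>m + 1\<close> from the earlier ones, as \<open>m + 1\<close> is
  invertible in characteristic 0.\<close>

lemma fps_eq_of_deriv_eq_mult:
  fixes f g :: "'a::field_char_0 fps"
  assumes f: "fps_deriv f = h * f" and g: "fps_deriv g = h * g"
    and 0: "fps_nth f 0 = fps_nth g 0"
  shows "f = g"
proof (rule fps_ext)
  fix n
  show "fps_nth f n = fps_nth g n"
  proof (induction n rule: less_induct)
    case (less n)
    show ?case
    proof (cases n)
      case (Suc m)
      have "fps_nth (h * f) m = fps_nth (h * g) m"
        unfolding fps_mult_nth by (intro sum.cong) (auto simp: less.IH Suc)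
      then have "fps_nth (fps_deriv f) m = fps_nth (fps_deriv g) m"
        by (simp only: f g)
      then show ?thesis
        by (simp add: Suc del: of_nat_Suc)
    qed (use 0 in simp)
  qed
qed

lemma fps_deriv_exp_compose:
  fixes h :: "'a::field_char_0 fps"
  assumes "fps_nth h 0 = 0"
  shows "fps_deriv (fps_exp 1 oo h) = fps_deriv h * (fps_exp 1 oo h)"
  using assms by (simp add: fps_compose_deriv mult.commute)

text \<open>Both sides solve y' = (g + h)' y and have constant term 1.\<close>

lemma fps_exp_compose_add:
  fixes g h :: "'a::field_char_0 fps"
  assumes g: "fps_nth g 0 = 0" and h: "fps_nth h 0 = 0"
  shows "fps_exp 1 oo (g + h) = (fps_exp 1 oo g) * (fps_exp 1 oo h)"
proof (rule fps_eq_of_deriv_eq_mult)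
  show "fps_deriv (fps_exp 1 oo (g + h)) = fps_deriv (g + h) * (fps_exp 1 oo (g + h))"
    by (rule fps_deriv_exp_compose) (simp add: g h)
  show "fps_deriv ((fps_exp 1 oo g) * (fps_exp 1 oo h)) =
      fps_deriv (g + h) * ((fps_exp 1 oo g) * (fps_exp 1 oo h))"
    by (simp add: fps_deriv_exp_compose g h algebra_simps)
qed simp

lemma fps_exp_compose_sum:
  fixes h :: "'i \<Rightarrow> 'a::field_char_0 fps"
  assumes "\<And>i. i \<in> S \<Longrightarrow> fps_nth (h i) 0 = 0"
  shows "fps_exp 1 oo (\<Sum>i\<in>S. h i) = (\<Prod>i\<in>S. fps_exp 1 oo h i)"
  using assms
  by (induction S rule: infinite_finite_induct)
    (simp_all add: fps_exp_compose_add fps_sum_nth)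

text \<open>The passage from sums to products. Each coefficient of the logarithms \<open>h i\<close>
  is nonzero for only finitely many \<open>i\<close>, so the possibly infinite sum \<open>s\<close>
  makes sense coefficientwise, and up to any fixed degree finite partial sums already equal
  it.\<close>

lemma fps_has_prod_exp_compose:
  fixes h :: "'i \<Rightarrow> rat fps"
  assumes 0: "\<And>i. i \<in> A \<Longrightarrow> fps_nth (h i) 0 = 0"
    and fin: "\<And>n. finite {i \<in> A. fps_nth (h i) n \<noteq> 0}"
    and s: "\<And>n. fps_nth s n = (\<Sum>i | i \<in> A \<and> fps_nth (h i) n \<noteq> 0. fps_nth (h i) n)"
  shows "fps_has_prod (\<lambda>i. fps_exp 1 oo h i) A (fps_exp 1 oo s)"
  unfolding fps_has_prod_def tendsto_fps_iff
proof
  fix n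
  \<comment> \<open>All indices contributing to some coefficient up to \<open>n\<close>: a
    composition depends on every lower coefficient of its inner series, not only on the
    \<open>n\<close>-th.\<close>
  define B where "B = (\<Union>j\<le>n. {i \<in> A. fps_nth (h i) j \<noteq> 0})"
  show "\<forall>\<^sub>F S in finite_subsets_at_top A.
      fps_nth (\<Prod>i\<in>S. fps_exp 1 oo h i) n = fps_nth (fps_exp 1 oo s) n"
    unfolding eventually_finite_subsets_at_top
  proof (intro exI conjI allI impI)
    show "finite B" "B \<subseteq> A"
      unfolding B_def using fin by auto
    fix S assume S: "finite S \<and> B \<subseteq> S \<and> S \<subseteq> A"
    have "fps_nth (\<Sum>i\<in>S. h i) j = fps_nth s j" if "j \<le> n" for j
      unfolding s fps_sum_nth
      by (rule sum.mono_neutral_right) (use S that in \<open>auto simp: B_def\<close>)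
    then show "fps_nth (\<Prod>i\<in>S. fps_exp 1 oo h i) n = fps_nth (fps_exp 1 oo s) n"
      using S 0 by (subst fps_exp_compose_sum [symmetric]) (auto intro: fps_nth_compose_cong)
  qed
qed

lemma fps_has_prod_cong:
  assumes "\<And>i. i \<in> A \<Longrightarrow> f i = g i"
  shows "fps_has_prod f A p \<longleftrightarrow> fps_has_prod g A p"
  unfolding fps_has_prod_def
  by (intro filterlim_cong refl eventually_finite_subsets_at_top_weakI prod.cong) (use assms in auto)

lemma fps_prodinf_eqI: "fps_has_prod f A p \<Longrightarrow> fps_prodinf f A = p"
  unfolding fps_has_prod_def fps_prodinf_def by (rule tendsto_Lim) simp_all

text \<open>From log(1 - z^m) = - sum of z^(m k) / k over k >= 1; with n = m k the coefficient 1 / k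
  becomes m / n.\<close>

lemma fps_ln_compose_uminus_X_power:
  assumes "m > 0"
  shows "fps_nth (fps_ln 1 oo - (fps_X ^ m)) n =
    (if n > 0 \<and> m dvd n then - (of_nat m / of_nat n) else 0 :: 'a::field_char_0)"
proof -
  have pow: "(- (fps_X ^ m) :: 'a fps) ^ i = fps_const ((- 1) ^ i) * fps_X ^ (m * i)" for i
    by (simp add: power_minus[of "fps_X ^ m"] power_mult fps_const_power[symmetric]
        flip: fps_const_neg)
  have nth: "fps_nth (fps_ln 1 oo - (fps_X ^ m)) n =
      (\<Sum>i=0..n. if n = m * i then fps_nth (fps_ln 1) i * (- 1) ^ i else (0::'a))"
    unfolding fps_compose_nth pow by (intro sum.cong) auto
  show ?thesis
  proof (cases "n > 0 \<and> m dvd n")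
    case True
    then obtain k where k: "n = m * k" by blast
    with True have "k > 0" by simp
    have "fps_nth (fps_ln 1 oo - (fps_X ^ m)) n =
        (\<Sum>i=0..n. if k = i then fps_nth (fps_ln 1) i * (- 1) ^ i else (0::'a))"
      unfolding nth using assms k by (intro sum.cong) auto
    also have "\<dots> = fps_nth (fps_ln 1) k * (- 1) ^ k"
      using assms k by simp
    \<comment> \<open>The sign (-1)^(k-1) from the logarithm meets (-1)^k from the substitution,
      leaving -1 for every \<open>k\<close>.\<close>
    also have "\<dots> = - (1 / of_nat k)"
      using \<open>k > 0\<close> by (cases k) (simp_all add: fps_ln_nth flip: power_mult_distrib del: of_nat_Suc)
    finally show ?thesis
      using True assms k by (simp del: of_nat_Suc)
  next
    case False
    then show ?thesis
      unfolding nth using assms by (cases "n = 0") (auto simp: intro!: sum.neutral)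
  qed
qed

section \<open>Integrality of coefficients\<close>

definition fps_int_coeffs :: "'a::ring_1 fps \<Rightarrow> bool" where
  "fps_int_coeffs f \<longleftrightarrow> (\<forall>n. fps_nth f n \<in> \<int>)"

lemma fps_int_coeffs_1: "fps_int_coeffs 1"
  by (simp add: fps_int_coeffs_def)

lemma fps_int_coeffs_mult: "fps_int_coeffs f \<Longrightarrow> fps_int_coeffs g \<Longrightarrow> fps_int_coeffs (f * g)"
  for f g :: "'a::comm_ring_1 fps"
  by (auto simp: fps_int_coeffs_def fps_mult_nth intro!: Ints_sum Ints_mult)

lemma fps_int_coeffs_prod: "(\<And>i. i \<in> A \<Longrightarrow> fps_int_coeffs (f i)) \<Longrightarrow> fps_int_coeffs (\<Prod>i\<in>A. f i)"
  for f :: "'i \<Rightarrow> 'a::comm_ring_1 fps"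
  by (induction A rule: infinite_finite_induct) (simp_all add: fps_int_coeffs_1 fps_int_coeffs_mult)

lemma fps_int_coeffs_power: "fps_int_coeffs f \<Longrightarrow> fps_int_coeffs (f ^ n)"
  for f :: "'a::comm_ring_1 fps"
  by (induction n) (simp_all add: fps_int_coeffs_1 fps_int_coeffs_mult)

text \<open>With constant term 1 the recursion for the coefficients of the inverse involves no
  division.\<close>

lemma fps_int_coeffs_inverse:
  fixes f :: "'a::field fps"
  assumes f: "fps_int_coeffs f" and 0: "fps_nth f 0 = 1"
  shows "fps_int_coeffs (inverse f)"
  unfolding fps_int_coeffs_def
proof
  fix n
  show "fps_nth (inverse f) n \<in> \<int>"
  proof (induction n rule: less_induct)
    case (less n)
    show ?case
    proof (cases n)
      case (Suc m)
      have "fps_nth (f * inverse f) n = 0"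
        using 0 by (subst inverse_mult_eq_1') (simp_all add: Suc)
      then have "fps_nth (inverse f) n = - (\<Sum>i=1..n. fps_nth f i * fps_nth (inverse f) (n - i))"
        using 0 by (simp add: fps_mult_nth sum.atLeast_Suc_atMost eq_neg_iff_add_eq_0)
      moreover have "(\<Sum>i=1..n. fps_nth f i * fps_nth (inverse f) (n - i)) \<in> \<int>"
        using f by (intro Ints_sum Ints_mult less.IH) (auto simp: fps_int_coeffs_def)
      ultimately show ?thesis
        by simp
    qed (simp add: 0)
  qed
qed

text \<open>X-adic convergence means that each coefficient of the limit is already a coefficient of
  some finite subproduct.\<close>

lemma fps_int_coeffs_has_prod:
  assumes p: "fps_has_prod f A p" and f: "\<And>i. i \<in> A \<Longrightarrow> fps_int_coeffs (f i)"
  shows "fps_int_coeffs p"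
  unfolding fps_int_coeffs_def
proof
  fix n
  have "\<forall>\<^sub>F S in finite_subsets_at_top A. fps_nth (\<Prod>i\<in>S. f i) n = fps_nth p n"
    using p unfolding fps_has_prod_def tendsto_fps_iff by blast
  then obtain S where "S \<subseteq> A" "fps_nth (\<Prod>i\<in>S. f i) n = fps_nth p n"
    unfolding eventually_finite_subsets_at_top by blast
  moreover from this f have "fps_int_coeffs (\<Prod>i\<in>S. f i)"
    by (blast intro: fps_int_coeffs_prod)
  ultimately show "fps_nth p n \<in> \<int>"
    unfolding fps_int_coeffs_def by metis
qed

text \<open>\<open>fps_ln 1\<close> is the compositional inverse of \<open>fps_exp 1 - 1\<close>;
  substituting \<open>h\<close> by associativity gives the general case.\<close>

lemma fps_exp_ln_compose:
  assumes "fps_nth h 0 = 0"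
  shows "fps_exp 1 oo (fps_ln 1 oo h) = (1 + h :: 'a::field_char_0 fps)"
proof -
  have "fps_exp 1 oo fps_ln 1 = (1 + fps_X :: 'a fps)"
    using fps_inv_fps_exp_compose(2)[of "1::'a"] fps_ln_fps_exp_inv[of "1::'a"]
    by (simp add: fps_compose_sub_distrib diff_eq_eq add.commute)
  then show ?thesis
    using assms by (subst fps_compose_assoc) (simp_all add: fps_compose_add_distrib)
qed

lemma fps_one_minus_powr_add:
  assumes "m > 0"
  shows "fps_one_minus_powr m (a + b) = fps_one_minus_powr m a * fps_one_minus_powr m b"
  unfolding fps_one_minus_powr_def
  by (subst fps_exp_compose_add [symmetric]) (simp_all add: distrib_right flip: fps_const_add)

lemma fps_one_minus_powr_of_nat:
  assumes "m > 0"
  shows "fps_one_minus_powr m (of_nat k) = (1 - fps_X ^ m) ^ k"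
proof (induction k)
  case 0
  show ?case by (simp add: fps_one_minus_powr_def)
next
  case (Suc k)
  have "fps_one_minus_powr m 1 = 1 - fps_X ^ m"
    using assms by (simp add: fps_one_minus_powr_def fps_exp_ln_compose)
  with Suc show ?case
    using assms by (simp add: fps_one_minus_powr_add)
qed

text \<open>A nonnegative exponent gives a power of the polynomial 1 - z^m. A negative one gives the
  inverse of such a power, whose constant term is 1.\<close>

lemma fps_int_coeffs_one_minus_powr:
  assumes m: "m > 0" and c: "c \<in> \<int>"
  shows "fps_int_coeffs (fps_one_minus_powr m c)"
proof -
  have nat: "fps_int_coeffs (fps_one_minus_powr m (of_nat k))" for k
    using m unfolding fps_one_minus_powr_of_nat[OF m]
    by (intro fps_int_coeffs_power) (simp add: fps_int_coeffs_def fps_X_power_iff)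
  from c obtain z where z: "c = of_int z"
    by (rule Ints_cases)
  show ?thesis
  proof (cases z rule: int_cases2)
    case (nonneg k)
    then show ?thesis using nat z by simp
  next
    case (nonpos k)
    have "fps_one_minus_powr m (of_nat k) * fps_one_minus_powr m c = 1"
      using fps_one_minus_powr_add[OF m, of "of_nat k" c] z nonpos
      by (simp add: fps_one_minus_powr_def)
    then have "fps_one_minus_powr m c = inverse (fps_one_minus_powr m (of_nat k))"
      by (metis fps_inverse_unique)
    moreover have "fps_nth (fps_one_minus_powr m (of_nat k)) 0 = 1"
      by (simp add: fps_one_minus_powr_def)
    ultimately show ?thesis
      using fps_int_coeffs_inverse nat by metis
  qed
qed


section \<open>Subgroups of finite index\<close>

context group
begin

lemma r_coset_eq_self_iff:
  "subgroup H G \<Longrightarrow> x \<in> carrier G \<Longrightarrow> H #> x = H \<longleftrightarrow> x \<in> H"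
  using coset_join1 coset_join2 by blast

text \<open>\<open>G\<close> acts on the right cosets of \<open>H\<close> by right multiplication,
  and the coset \<open>H\<close> has stabilizer \<open>H\<close>. Numbering the cosets transports
  this action to the numbers below \<open>n\<close>; being a right action, it reverses the order of
  composition.\<close>

lemma subgroup_of_index_is_point_stabilizer:
  assumes "H \<in> subgroups_of_index G n"
  shows "\<exists>i t. i < n \<and> (\<forall>j<n. t \<one> j = j) \<and> (\<forall>g\<in>carrier G. \<forall>j<n. t g j < n) \<and>
    (\<forall>g\<in>carrier G. \<forall>h\<in>carrier G. \<forall>j<n. t (g \<otimes> h) j = t h (t g j)) \<and>
    H = {g \<in> carrier G. t g i = i}"
proof -
  have H: "subgroup H G" and fin: "finite (rcosets H)" and n: "card (rcosets H) = n"
    using assms by (auto simp: subgroups_of_index_def finite_index_subgroups_def subgroup_index_def)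
  obtain f where f: "bij_betw f {..<n} (rcosets H)"
    using ex_bij_betw_nat_finite[OF fin] n by (auto simp: atLeast0LessThan)
  define p where "p = inv_into {..<n} f"
  have p: "bij_betw p (rcosets H) {..<n}"
    unfolding p_def by (rule bij_betw_inv_into[OF f])
  have pf: "p (f j) = j" if "j < n" for j
    unfolding p_def using f that by (intro bij_betw_inv_into_left) auto
  have fp: "f (p C) = C" if "C \<in> rcosets H" for C
    unfolding p_def using f that by (intro bij_betw_inv_into_right)
  have f_in: "f j \<in> rcosets H" if "j < n" for j
    using f that by (auto simp: bij_betw_def)
  have p_less: "p C < n" if "C \<in> rcosets H" for C
    using p that by (auto simp: bij_betw_def)
  have f_sub: "f j \<subseteq> carrier G" if "j < n" for j
    using subgroup.rcosets_carrier[OF H is_group f_in[OF that]] .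
  have mult: "C #> g \<in> rcosets H" if "C \<in> rcosets H" "g \<in> carrier G" for C g
    using that subgroup.subset[OF H] by (auto simp: RCOSETS_def coset_mult_assoc)
  have HH: "H \<in> rcosets H"
    using subgroup.subgroup_in_rcosets[OF H is_group] .
  have "g \<in> H \<longleftrightarrow> p (f (p H) #> g) = p H" if "g \<in> carrier G" for g
  proof -
    have "p (H #> g) = p H \<longleftrightarrow> H #> g = H"
      using p mult[OF HH that] HH by (auto simp: bij_betw_def inj_on_def)
    then show ?thesis
      using that by (simp add: fp HH r_coset_eq_self_iff[OF H])
  qed
  then have "H = {g \<in> carrier G. p (f (p H) #> g) = p H}"
    using subgroup.subset[OF H] by auto
  moreover have "\<forall>j<n. p (f j #> \<one>) = j"
    by (simp add: f_sub pf)
  moreover have "\<forall>g\<in>carrier G. \<forall>j<n. p (f j #> g) < n"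
    by (simp add: p_less mult f_in)
  moreover have "\<forall>g\<in>carrier G. \<forall>h\<in>carrier G. \<forall>j<n. p (f j #> (g \<otimes> h)) = p (f (p (f j #> g)) #> h)"
    by (simp add: fp mult f_in coset_mult_assoc f_sub)
  ultimately show ?thesis
    using p_less[OF HH] by (intro exI[of _ "p H"] exI[of _ "\<lambda>g j. p (f j #> g)"]) blast
qed

text \<open>
  The action on the numbered cosets is determined by the generators, and \<open>H\<close> is recovered from it
  as a point stabilizer, so there are at most as many \<open>H\<close> as maps from the generators to
  self-maps of \<open>n\<close> points, times \<open>n\<close>.
\<close>

lemma finite_subgroups_of_index:
  assumes "finitely_generated G"
  shows "finite (subgroups_of_index G n)"
proof -
  obtain S where S: "finite S" "S \<subseteq> carrier G" "generate G S = carrier G"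
    using assms by (auto simp: finitely_generated_def)
  define P where "P H i t \<longleftrightarrow> i < n \<and> (\<forall>j<n. t \<one> j = j) \<and> (\<forall>g\<in>carrier G. \<forall>j<n. t g j < n) \<and>
    (\<forall>g\<in>carrier G. \<forall>h\<in>carrier G. \<forall>j<n. t (g \<otimes> h) j = t h (t g j)) \<and>
    H = {g \<in> carrier G. t g i = i}" for H i t
  have "\<forall>H\<in>subgroups_of_index G n. \<exists>i t. P H i t"
    unfolding P_def using subgroup_of_index_is_point_stabilizer by blast
  then obtain i t where "\<forall>H\<in>subgroups_of_index G n. P H (i H) (t H)"
    by metis
  then have P: "P H (i H) (t H)" if "H \<in> subgroups_of_index G n" for H
    using that by blast
  have less: "i H < n" if "H \<in> subgroups_of_index G n" for H
    using P[OF that] by (simp add: P_def)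
  have t_one: "t H \<one> j = j" if "H \<in> subgroups_of_index G n" "j < n" for H j
    using P[OF that(1)] that(2) by (simp add: P_def)
  have closed: "t H g j < n" if "H \<in> subgroups_of_index G n" "g \<in> carrier G" "j < n" for H g j
    using P[OF that(1)] that(2,3) by (simp add: P_def)
  have mult: "t H (g \<otimes> h) j = t H h (t H g j)"
    if "H \<in> subgroups_of_index G n" "g \<in> carrier G" "h \<in> carrier G" "j < n" for H g h j
    using P[OF that(1)] that(2-4) by (simp add: P_def)
  have stab: "H = {g \<in> carrier G. t H g (i H) = i H}" if "H \<in> subgroups_of_index G n" for H
    using P[OF that] unfolding P_def by blast
  \<comment> \<open>Only the base point and the action of the generators are recorded. The
    restrictions fix the values outside \<open>S\<close> and \<open>{..<n}\<close>, so that the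
    codes lie in a finite function space.\<close>
  define enc where "enc H = (i H, \<lambda>s\<in>S. \<lambda>j\<in>{..<n}. t H s j)" for H
  have "inj_on enc (subgroups_of_index G n)"
  proof (rule inj_onI)
    fix H K assume H: "H \<in> subgroups_of_index G n" and K: "K \<in> subgroups_of_index G n"
      and eq: "enc H = enc K"
    have i: "i H = i K"
      using eq by (simp add: enc_def)
    have base: "t H s j = t K s j" if "s \<in> S" "j < n" for s j
    proof -
      have "(\<lambda>s\<in>S. \<lambda>j\<in>{..<n}. t H s j) s j = (\<lambda>s\<in>S. \<lambda>j\<in>{..<n}. t K s j) s j"
        using eq by (simp add: enc_def)
      then show ?thesis
        using that by simp
    qed
    have "\<forall>j<n. t H g j = t K g j" if "g \<in> generate G S" for g
      using that
    proof induction
      case one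
      then show ?case by (simp add: t_one H K)
    next
      case (incl s)
      then show ?case by (simp add: base)
    next
      case (inv s)
      then have s: "s \<in> carrier G" using S by blast
      show ?case
      proof (intro allI impI)
        fix j assume j: "j < n"
        \<comment> \<open>The point that \<open>s\<close> sends back to \<open>j\<close>. The two
          actions agree on \<open>s\<close>, so \<open>s\<close> sends \<open>k\<close> to
          \<open>j\<close> under \<open>K\<close> too, and \<open>inv s\<close> must then send
          \<open>j\<close> to \<open>k\<close>.\<close>
        define k where "k = t H (inv s) j"
        have k: "k < n"
          using closed[OF H] s j by (simp add: k_def)
        have "t H s k = j"
          using mult[OF H, of "inv s" s j] t_one[OF H] s j by (simp add: k_def)
        then have "t K s k = j"
          using base inv.hyps k by simp
        then have "t K (inv s) j = k"
          using mult[OF K, of s "inv s" k] t_one[OF K] s k by simp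
        then show "t H (inv s) j = t K (inv s) j"
          by (simp add: k_def)
      qed
    next
      case (eng g h)
      then have "g \<in> carrier G" "h \<in> carrier G"
        using S(3) by blast+
      then show ?case
        using eng.IH closed[OF K] by (simp add: mult H K)
    qed
    then have "t H g (i H) = t K g (i K)" if "g \<in> carrier G" for g
      using that S(3) less[OF H] i by simp
    then have "{g \<in> carrier G. t H g (i H) = i H} = {g \<in> carrier G. t K g (i K) = i K}"
      using i by auto
    then show "H = K"
      using stab[OF H] stab[OF K] by simp
  qed
  moreover have "enc ` subgroups_of_index G n \<subseteq> {..<n} \<times> (S \<rightarrow>\<^sub>E {..<n} \<rightarrow>\<^sub>E {..<n})"
    using less closed S(2) by (auto simp: enc_def PiE_iff extensional_def split: if_splits)
  moreover have "finite ({..<n} \<times> (S \<rightarrow>\<^sub>E {..<n} \<rightarrow>\<^sub>E {..<n}))"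
    using S(1) by (intro finite_cartesian_product finite_PiE) auto
  ultimately show ?thesis
    using inj_on_finite by blast
qed

section \<open>Indices in towers of subgroups\<close>

text \<open>After choosing a representative \<open>t C\<close> of each coset \<open>C\<close> of
  \<open>K\<close>, every coset of \<open>H\<close> is H k (t C) for a unique \<open>C\<close> and a
  unique coset H k inside \<open>K\<close>. A bijection yields both the index formula and the
  transfer of finiteness.\<close>

lemma bij_betw_rcosets_subgroup:
  assumes H: "subgroup H G" and K: "subgroup K G" and "H \<subseteq> K"
  shows "\<exists>f. bij_betw f ((rcosets K) \<times> (rcosets\<^bsub>G\<lparr>carrier := K\<rparr>\<^esub> H)) (rcosets H)"
proof
  define t where "t C = (SOME a. a \<in> carrier G \<and> C = K #> a)" for C
  have t: "t C \<in> carrier G" "C = K #> t C" if "C \<in> rcosets K" for C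
  proof -
    have "\<exists>a. a \<in> carrier G \<and> C = K #> a"
      using that by (auto simp: RCOSETS_def)
    from someI_ex[OF this] show "t C \<in> carrier G" "C = K #> t C"
      by (simp_all add: t_def)
  qed
  have HG: "H \<subseteq> carrier G" and KG: "K \<subseteq> carrier G"
    using H K by (auto dest: subgroup.subset)
  have rcosets_K: "rcosets\<^bsub>G\<lparr>carrier := K\<rparr>\<^esub> H = (\<lambda>k. H #> k) ` K"
    by (auto simp: RCOSETS_def)
  show "bij_betw (\<lambda>(C, D). D #> t C) ((rcosets K) \<times> (rcosets\<^bsub>G\<lparr>carrier := K\<rparr>\<^esub> H)) (rcosets H)"
    unfolding bij_betw_def rcosets_K
  proof
    show "inj_on (\<lambda>(C, D). D #> t C) ((rcosets K) \<times> (\<lambda>k. H #> k) ` K)"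
    proof (rule inj_onI, clarify)
      fix C C' k k'
      assume C: "C \<in> rcosets K" "C' \<in> rcosets K" and k: "k \<in> K" "k' \<in> K"
        and eq: "H #> k #> t C = H #> k' #> t C'"
      have kG: "k \<in> carrier G" "k' \<in> carrier G"
        using k KG by auto
      \<comment> \<open>Since \<open>H\<close> is contained in \<open>K\<close>, this element lies
        in both \<open>C\<close> and \<open>C'\<close>, forcing \<open>C = C'\<close>; then
        \<open>t C\<close> can be cancelled on the right.\<close>
      have "k \<otimes> t C \<in> H #> (k' \<otimes> t C')"
        using eq rcos_self[of "k \<otimes> t C" H] H HG kG t(1) C by (simp add: coset_mult_assoc)
      then obtain h where h: "h \<in> H" "k \<otimes> t C = h \<otimes> (k' \<otimes> t C')"
        by (auto simp: r_coset_def)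
      have "k \<otimes> t C \<in> K #> t C"
        using k(1) by (auto simp: r_coset_def)
      moreover have "k \<otimes> t C \<in> K #> t C'"
      proof -
        have "k \<otimes> t C = (h \<otimes> k') \<otimes> t C'"
          using h HG kG t(1) C by (metis m_assoc subsetD)
        moreover have "h \<otimes> k' \<in> K"
          using h(1) \<open>H \<subseteq> K\<close> k(2) subgroup.m_closed[OF K] by blast
        ultimately show ?thesis
          by (auto simp: r_coset_def)
      qed
      ultimately have CC: "C = C'"
        using rcos_disjoint[OF K] C t(2) by (metis IntI disjnt_def empty_iff pairwiseD)
      have "H #> k = H #> k #> t C #> inv (t C)"
        using HG kG t(1) C by (simp add: coset_mult_assoc m_assoc)
      also have "\<dots> = H #> k' #> t C #> inv (t C)"
        using eq CC by simp
      also have "\<dots> = H #> k'"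
        using HG kG t(1) C by (simp add: coset_mult_assoc m_assoc)
      finally show "C = C' \<and> H #> k = H #> k'"
        using CC by simp
    qed
    show "(\<lambda>(C, D). D #> t C) ` ((rcosets K) \<times> (\<lambda>k. H #> k) ` K) = rcosets H"
    proof (intro equalityI subsetI)
      fix D assume "D \<in> (\<lambda>(C, D). D #> t C) ` ((rcosets K) \<times> (\<lambda>k. H #> k) ` K)"
      then obtain C k where "C \<in> rcosets K" "k \<in> carrier G" "D = H #> k #> t C"
        using KG by auto
      then show "D \<in> rcosets H"
        using t(1) HG by (simp add: coset_mult_assoc rcosetsI)
    next
      fix D assume "D \<in> rcosets H"
      then obtain g where g: "g \<in> carrier G" "D = H #> g"
        by (auto simp: RCOSETS_def)
      have C: "K #> g \<in> rcosets K"
        using g KG by (auto intro: rcosetsI)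
      have "g \<in> K #> t (K #> g)"
        using t(2)[OF C] rcos_self[OF g(1) K] by simp
      then obtain k where k: "k \<in> K" "g = k \<otimes> t (K #> g)"
        by (auto simp: r_coset_def)
      then have "D = H #> k #> t (K #> g)"
        using g t(1)[OF C] HG KG by (metis coset_mult_assoc subsetD)
      then show "D \<in> (\<lambda>(C, D). D #> t C) ` ((rcosets K) \<times> (\<lambda>k. H #> k) ` K)"
        using C k(1) by force
    qed
  qed
qed

lemma subgroup_index_mult:
  assumes "subgroup H G" "subgroup K G" "H \<subseteq> K"
  shows "subgroup_index G H = subgroup_index G K * subgroup_index (G\<lparr>carrier := K\<rparr>) H"
  using bij_betw_rcosets_subgroup[OF assms]
  by (auto simp: subgroup_index_def card_cartesian_product dest!: bij_betw_same_card)

lemma finite_rcosets_iff: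
  assumes "subgroup H G" "subgroup K G" "H \<subseteq> K"
  shows "finite (rcosets H) \<longleftrightarrow> finite (rcosets K) \<and> finite (rcosets\<^bsub>G\<lparr>carrier := K\<rparr>\<^esub> H)"
proof -
  \<comment> \<open>A finite product has finite factors only when neither factor is empty.\<close>
  have "rcosets K \<noteq> {}" "rcosets\<^bsub>G\<lparr>carrier := K\<rparr>\<^esub> H \<noteq> {}"
    using assms subgroup.one_closed by (fastforce simp: RCOSETS_def)+
  then show ?thesis
    using bij_betw_rcosets_subgroup[OF assms]
    by (auto dest!: bij_betw_finite simp: finite_cartesian_product_iff)
qed

text \<open>The tower law, where the positive finite index of \<open>K\<close> can be cancelled. It
  turns counting inside a stabilizer into counting in \<open>G\<close>.\<close>

lemma subgroups_of_index_subgroup: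
  assumes "K \<in> finite_index_subgroups G"
  shows "subgroups_of_index (G\<lparr>carrier := K\<rparr>) m =
    {H \<in> subgroups_of_index G (subgroup_index G K * m). H \<subseteq> K}"
proof -
  have K: "subgroup K G" "finite (rcosets K)"
    using assms by (auto simp: finite_index_subgroups_def)
  have pos: "subgroup_index G K > 0"
    using K subgroup.subgroup_in_rcosets[OF K(1) is_group]
    by (auto simp: subgroup_index_def card_gt_0_iff)
  have "subgroup H (G\<lparr>carrier := K\<rparr>) \<longleftrightarrow> subgroup H G \<and> H \<subseteq> K" for H
    using incl_subgroup[OF K(1)] subgroup_incl[OF _ K(1)] subgroup.subset by fastforce
  then show ?thesis
    using K(2) pos finite_rcosets_iff[OF _ K(1)] subgroup_index_mult[OF _ K(1)]
    unfolding subgroups_of_index_def finite_index_subgroups_def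
    by (smt (verit) Collect_cong mem_Collect_eq mult_cancel1 not_gr_zero)
qed

text \<open>(g H g^-1) a = g (H (g^-1 a)), so left translation by \<open>g\<close> matches the two
  sets of cosets. Being injective, it preserves the index under conjugation.\<close>

lemma rcosets_conjugate:
  assumes g: "g \<in> carrier G" and H: "H \<subseteq> carrier G"
  shows "rcosets (g <# H #> inv g) = (\<lambda>C. g <# C) ` (rcosets H)"
proof -
  have right: "(g <# H #> inv g) #> a = g <# (H #> (inv g \<otimes> a))" if "a \<in> carrier G" for a
    using g H that by (simp add: coset_assoc coset_mult_assoc l_coset_subset_G)
  have left: "g <# (H #> b) = (g <# H #> inv g) #> (g \<otimes> b)" if "b \<in> carrier G" for b
    using g H that
    by (simp add: coset_assoc coset_mult_assoc l_coset_subset_G m_assoc [symmetric])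
  show ?thesis
  proof (intro equalityI subsetI)
    fix C assume "C \<in> rcosets (g <# H #> inv g)"
    then obtain a where a: "a \<in> carrier G" "C = (g <# H #> inv g) #> a"
      by (auto simp: RCOSETS_def)
    have "H #> (inv g \<otimes> a) \<in> rcosets H"
      using a g H by (intro rcosetsI) auto
    then show "C \<in> (\<lambda>C. g <# C) ` (rcosets H)"
      using right[OF a(1)] a(2) by blast
  next
    fix C assume "C \<in> (\<lambda>C. g <# C) ` (rcosets H)"
    then obtain b where b: "b \<in> carrier G" "C = g <# (H #> b)"
      by (auto simp: RCOSETS_def)
    then show "C \<in> rcosets (g <# H #> inv g)"
      using left[OF b(1)] g H by (simp add: rcosetsI r_coset_subset_G l_coset_subset_G)
  qed
qed

lemma inj_on_l_coset: "g \<in> carrier G \<Longrightarrow> inj_on (\<lambda>C. g <# C) (Pow (carrier G))"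
  by (rule inj_on_inverseI[where g = "\<lambda>C. inv g <# C"]) (auto simp: lcos_m_assoc lcos_mult_one)

lemma conjugate_in_subgroups_of_index:
  assumes g: "g \<in> carrier G" and "H \<in> subgroups_of_index G n"
  shows "g <# H #> inv g \<in> subgroups_of_index G n"
proof -
  have H: "subgroup H G" "finite (rcosets H)" "card (rcosets H) = n"
    using assms by (auto simp: subgroups_of_index_def finite_index_subgroups_def subgroup_index_def)
  have "inj_on (\<lambda>C. g <# C) (rcosets H)"
    using inj_on_l_coset[OF g] rcosets_subset_PowG[OF H(1)] by (rule inj_on_subset)
  then show ?thesis
    using H g subgroup_conjugation_is_surj2[OF g H(1)] rcosets_conjugate[OF g subgroup.subset[OF H(1)]]
    by (simp add: subgroups_of_index_def finite_index_subgroups_def subgroup_index_def card_image)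
qed

end


section \<open>Orbits\<close>

context group_action
begin

interpretation group G
  using group_hom group_hom.axioms(1) by blast

lemma stabilizer_in_finite_index_subgroups:
  assumes "x \<in> E" "finite (orbit G \<phi> x)"
  shows "stabilizer G \<phi> x \<in> finite_index_subgroups G"
  using stabilizer_subgroup[OF assms(1)] bij_betw_finite[OF orbit_stab_fun_is_bij[OF assms(1)]] assms(2)
  by (simp add: finite_index_subgroups_def)

lemma subgroup_index_stabilizer:
  assumes "x \<in> E"
  shows "subgroup_index G (stabilizer G \<phi> x) = card (orbit G \<phi> x)"
  using bij_betw_same_card[OF orbit_stab_fun_is_bij[OF assms]] by (simp add: subgroup_index_def)

text \<open>By the tower law the index of the stabilizer divides that of \<open>H\<close>, and by
  orbit-stabilizer it is the size of the orbit.\<close>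

lemma orbit_finite_and_card_dvd:
  assumes x: "x \<in> E" and H: "H \<in> subgroups_of_index G n" "H \<subseteq> stabilizer G \<phi> x"
  shows "finite (orbit G \<phi> x)" "card (orbit G \<phi> x) dvd n"
proof -
  have sub: "subgroup H G" "finite (rcosets H)" "subgroup_index G H = n"
    using H by (auto simp: subgroups_of_index_def finite_index_subgroups_def)
  show "finite (orbit G \<phi> x)"
    using bij_betw_finite[OF orbit_stab_fun_is_bij[OF x]]
      finite_rcosets_iff[OF sub(1) stabilizer_subgroup[OF x] H(2)] sub(2) by simp
  show "card (orbit G \<phi> x) dvd n"
    using subgroup_index_mult[OF sub(1) stabilizer_subgroup[OF x] H(2)] sub(3)
      subgroup_index_stabilizer[OF x] by simp
qed

lemma orbits_disjoint: "pairwise disjnt (orbits G E \<phi>)"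
  using orbit_partition by (auto simp: partition_def pairwise_def disjnt_def)

lemma orbit_eq:
  assumes "Y \<in> orbits G E \<phi>" "y \<in> Y"
  shows "y \<in> E" "orbit G \<phi> y = Y"
proof -
  show y: "y \<in> E"
    using assms element_image by (auto simp: orbits_def orbit_def)
  have "orbit G \<phi> y \<in> orbits G E \<phi>" "y \<in> orbit G \<phi> y"
    using y orbit_refl by (auto simp: orbits_def)
  then show "orbit G \<phi> y = Y"
    using assms orbits_disjoint by (auto simp: pairwise_def disjnt_def)
qed

lemma conjugate_subset_stabilizer:
  assumes x: "x \<in> E" and g: "g \<in> carrier G" and H: "H \<subseteq> stabilizer G \<phi> x"
  shows "g <# H #> inv g \<subseteq> stabilizer G \<phi> (\<phi> g x)"
proof
  fix a assume "a \<in> g <# H #> inv g"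
  then obtain h where h: "h \<in> H" "a = g \<otimes> h \<otimes> inv g"
    by (auto simp: l_coset_def r_coset_def)
  then have hG: "h \<in> carrier G" and hx: "\<phi> h x = x"
    using H by (auto simp: stabilizer_def)
  have gx: "\<phi> g x \<in> E"
    using element_image[OF g x] by simp
  have "\<phi> a (\<phi> g x) = \<phi> (g \<otimes> h) (\<phi> (inv g) (\<phi> g x))"
    using h g hG gx by (simp add: composition_rule)
  also have "\<dots> = \<phi> g x"
    using orbit_sym_aux[OF g x refl] g hG x hx by (simp add: composition_rule)
  finally show "a \<in> stabilizer G \<phi> (\<phi> g x)"
    using h g hG by (simp add: stabilizer_def)
qed

text \<open>If y = g x, conjugation by \<open>g\<close> injects the subgroups fixing
  \<open>x\<close> into those fixing \<open>y\<close>; exchanging the points gives the reverse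
  inequality.\<close>

lemma card_subgroups_in_stabilizer_cong:
  assumes fin: "finite (subgroups_of_index G n)"
    and Y: "Y \<in> orbits G E \<phi>" "x \<in> Y" "y \<in> Y"
  shows "card {H \<in> subgroups_of_index G n. H \<subseteq> stabilizer G \<phi> x} =
    card {H \<in> subgroups_of_index G n. H \<subseteq> stabilizer G \<phi> y}"
proof -
  have "card {H \<in> subgroups_of_index G n. H \<subseteq> stabilizer G \<phi> x} \<le>
    card {H \<in> subgroups_of_index G n. H \<subseteq> stabilizer G \<phi> y}" if xy: "x \<in> Y" "y \<in> Y" for x y
  proof -
    have x: "x \<in> E" and "y \<in> orbit G \<phi> x"
      using orbit_eq[OF Y(1)] xy by auto
    then obtain g where g: "g \<in> carrier G" "y = \<phi> g x"
      by (auto simp: orbit_def)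
    show ?thesis
    proof (rule card_inj_on_le)
      show "inj_on (\<lambda>H. g <# H #> inv g) {H \<in> subgroups_of_index G n. H \<subseteq> stabilizer G \<phi> x}"
        by (rule inj_onI, rule subgroup_conjugation_is_inj[OF g(1)])
          (use stabilizer_subset[of x] in auto)
      show "(\<lambda>H. g <# H #> inv g) ` {H \<in> subgroups_of_index G n. H \<subseteq> stabilizer G \<phi> x}
          \<subseteq> {H \<in> subgroups_of_index G n. H \<subseteq> stabilizer G \<phi> y}"
        using conjugate_in_subgroups_of_index[OF g(1)] conjugate_subset_stabilizer[OF x g(1)] g(2)
        by auto
    qed (use fin in simp)
  qed
  from this[OF Y(2,3)] this[OF Y(3,2)] show ?thesis
    by simp
qed

lemma mem_fixed_points_iff:
  assumes "H \<subseteq> carrier G"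
  shows "x \<in> fixed_points E \<phi> H \<longleftrightarrow> x \<in> E \<and> H \<subseteq> stabilizer G \<phi> x"
  using assms by (auto simp: fixed_points_def stabilizer_def)

text \<open>Each point of an orbit of size k <= n is fixed by its stabilizer, of index
  \<open>k\<close>. There are finitely many subgroups of index at most \<open>n\<close>, each with
  finitely many fixed points.\<close>

lemma finite_orbits_card_dvd:
  assumes fin: "\<And>n. finite (subgroups_of_index G n)"
    and fix_fin: "\<And>L. L \<in> finite_index_subgroups G \<Longrightarrow> finite (fixed_points E \<phi> L)"
    and n: "n > 0"
  shows "finite {Y \<in> finite_orbits G E \<phi>. card Y dvd n}"
proof (rule finite_subset)
  show "{Y \<in> finite_orbits G E \<phi>. card Y dvd n} \<subseteq>
      orbit G \<phi> ` (\<Union>k\<le>n. \<Union>L\<in>subgroups_of_index G k. fixed_points E \<phi> L)"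
  proof
    fix Y assume "Y \<in> {Y \<in> finite_orbits G E \<phi>. card Y dvd n}"
    then obtain y where y: "y \<in> E" "Y = orbit G \<phi> y" "finite Y" "card Y \<le> n"
      using n by (auto simp: finite_orbits_def orbits_def dest: dvd_imp_le)
    have "stabilizer G \<phi> y \<in> subgroups_of_index G (card Y)"
      using y stabilizer_in_finite_index_subgroups subgroup_index_stabilizer
      by (simp add: subgroups_of_index_def)
    moreover have "y \<in> fixed_points E \<phi> (stabilizer G \<phi> y)"
      using y by (auto simp: fixed_points_def stabilizer_def)
    ultimately show "Y \<in> orbit G \<phi> ` (\<Union>k\<le>n. \<Union>L\<in>subgroups_of_index G k. fixed_points E \<phi> L)"
      using y by blast
  qed
  show "finite (orbit G \<phi> ` (\<Union>k\<le>n. \<Union>L\<in>subgroups_of_index G k. fixed_points E \<phi> L))"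
    by (intro finite_imageI finite_UN_I fin fix_fin) (simp_all add: subgroups_of_index_def)
qed

text \<open>Double counting of the pairs of a subgroup \<open>L\<close> of index \<open>n\<close>
  and a point fixed by it, grouped by orbits; \<open>r\<close> picks the point of each orbit whose
  stabilizer is used.\<close>

lemma sum_card_fixed_points:
  assumes fin: "\<And>n. finite (subgroups_of_index G n)"
    and fix_fin: "\<And>L. L \<in> finite_index_subgroups G \<Longrightarrow> finite (fixed_points E \<phi> L)"
    and r: "\<And>Y. Y \<in> finite_orbits G E \<phi> \<Longrightarrow> r Y \<in> Y"
    and n: "n > 0"
  shows "(\<Sum>L\<in>subgroups_of_index G n. card (fixed_points E \<phi> L)) =
    (\<Sum>Y | Y \<in> finite_orbits G E \<phi> \<and> card Y dvd n.
      card Y * card (subgroups_of_index (G\<lparr>carrier := stabilizer G \<phi> (r Y)\<rparr>) (n div card Y)))"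
proof -
  define O' where "O' = {Y \<in> finite_orbits G E \<phi>. card Y dvd n}"
  define S where "S = subgroups_of_index G n"
  have finO: "finite O'"
    unfolding O'_def by (rule finite_orbits_card_dvd[OF fin fix_fin n])
  have OD: "Y \<in> orbits G E \<phi>" "finite Y" "card Y dvd n" "r Y \<in> Y" if "Y \<in> O'" for Y
    using that r by (auto simp: O'_def finite_orbits_def)
  have finU: "finite (\<Union>O')"
    using finO OD by blast
  have finS: "finite S"
    using fin by (simp add: S_def)
  \<comment> \<open>Fixed points of \<open>L\<close> lie in orbits of size dividing
    \<open>n\<close>, so the count takes place in the finite set \<open>\<Union>O'\<close> and the
    two sums can be exchanged.\<close>
  have fp: "fixed_points E \<phi> L = {x \<in> \<Union>O'. L \<subseteq> stabilizer G \<phi> x}" if L: "L \<in> S" for L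
  proof -
    have LG: "L \<subseteq> carrier G"
      using L by (auto simp: S_def subgroups_of_index_def finite_index_subgroups_def dest: subgroup.subset)
    have "x \<in> \<Union>O'" if "x \<in> E" "L \<subseteq> stabilizer G \<phi> x" for x
    proof
      show "x \<in> orbit G \<phi> x" using that orbit_refl by simp
      show "orbit G \<phi> x \<in> O'"
        using that L orbit_finite_and_card_dvd[of x L n]
        by (auto simp: O'_def S_def finite_orbits_def orbits_def)
    qed
    moreover have "x \<in> E" if "x \<in> \<Union>O'" for x
      using that orbit_eq(1) OD(1) by blast
    ultimately show ?thesis
      using mem_fixed_points_iff[OF LG] by blast
  qed
  have "(\<Sum>L\<in>S. card (fixed_points E \<phi> L)) =
      (\<Sum>L\<in>S. \<Sum>x | x \<in> \<Union>O' \<and> L \<subseteq> stabilizer G \<phi> x. 1)"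
    by (simp add: fp)
  also have "\<dots> = (\<Sum>x\<in>\<Union>O'. \<Sum>L | L \<in> S \<and> L \<subseteq> stabilizer G \<phi> x. 1)"
    by (rule sum.swap_restrict[OF finS finU])
  also have "\<dots> = (\<Sum>Y\<in>O'. \<Sum>x\<in>Y. card {L \<in> S. L \<subseteq> stabilizer G \<phi> x})"
    using OD orbits_disjoint by (subst sum.Union_disjoint) (auto simp: pairwise_def disjnt_def)
  also have "\<dots> = (\<Sum>Y\<in>O'. card Y * card {L \<in> S. L \<subseteq> stabilizer G \<phi> (r Y)})"
  proof (rule sum.cong[OF refl])
    fix Y assume Y: "Y \<in> O'"
    have "card {L \<in> S. L \<subseteq> stabilizer G \<phi> x} = card {L \<in> S. L \<subseteq> stabilizer G \<phi> (r Y)}"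
      if "x \<in> Y" for x
      unfolding S_def using OD[OF Y] that by (intro card_subgroups_in_stabilizer_cong fin) auto
    then show "(\<Sum>x\<in>Y. card {L \<in> S. L \<subseteq> stabilizer G \<phi> x}) =
        card Y * card {L \<in> S. L \<subseteq> stabilizer G \<phi> (r Y)}"
      by simp
  qed
  \<comment> \<open>The stabilizer has index \<open>card Y\<close>, so its subgroups of index
    \<open>n\<close> in \<open>G\<close> are those of index \<open>n div card Y\<close> in
    it.\<close>
  also have "\<dots> = (\<Sum>Y\<in>O'. card Y *
      card (subgroups_of_index (G\<lparr>carrier := stabilizer G \<phi> (r Y)\<rparr>) (n div card Y)))"
  proof (rule sum.cong[OF refl])
    fix Y assume Y: "Y \<in> O'"
    have y: "r Y \<in> E" "orbit G \<phi> (r Y) = Y"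
      using orbit_eq[of Y "r Y"] OD[OF Y] by auto
    show "card Y * card {L \<in> S. L \<subseteq> stabilizer G \<phi> (r Y)} = card Y *
        card (subgroups_of_index (G\<lparr>carrier := stabilizer G \<phi> (r Y)\<rparr>) (n div card Y))"
      using y OD[OF Y] stabilizer_in_finite_index_subgroups[OF y(1)]
      by (simp add: subgroups_of_index_subgroup subgroup_index_stabilizer S_def)
  qed
  finally show ?thesis
    unfolding S_def O'_def .
qed

end

section \<open>The contribution of a single orbit\<close>

text \<open>The defining identity of the quotient series: the shifted Riemann zeta function has
  coefficient d / m at m / d, and leading coefficient 1, so division by it is legitimate.\<close>

lemma sum_group_Delta_mult:
  assumes "m > 0"
  shows "(\<Sum>d | d dvd m. group_Delta H d * (of_nat d / of_nat m)) =
    of_nat (card (subgroups_of_index H m)) / of_nat m"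
proof -
  have "(\<Sum>d | d dvd m. group_Delta H d * (of_nat d / of_nat m)) =
      dirichlet_mult (group_Delta H) (dirichlet_shift riemann_zeta) m"
    unfolding dirichlet_mult_def dirichlet_shift_def riemann_zeta_def using assms
    by (auto intro!: sum.cong elim!: dvdE)
  also have "\<dots> = dirichlet_shift (group_zeta H) m"
    unfolding group_Delta_def using assms
    by (intro dirichlet_mult_divide) (simp_all add: dirichlet_shift_def riemann_zeta_def)
  finally show ?thesis
    by (simp add: dirichlet_shift_def group_zeta_def)
qed

text \<open>The logarithm of the inner product for \<open>Y\<close>, with the summation index
  \<open>m\<close> recovered as \<open>n div card Y\<close>. The guard \<open>n > 0\<close> makes
  the constant term 0, as the exponential requires.\<close>

definition orbit_log ::
    "('a, 'c) monoid_scheme \<Rightarrow> ('a \<Rightarrow> 'x \<Rightarrow> 'x) \<Rightarrow> 'x set \<Rightarrow> 'x \<Rightarrow> rat fps" where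
  "orbit_log G \<alpha> Y y = Abs_fps (\<lambda>n. if n > 0 \<and> card Y dvd n
     then of_nat (card (subgroups_of_index (G\<lparr>carrier := stabilizer G \<alpha> y\<rparr>) (n div card Y))) /
       of_nat (n div card Y)
     else 0)"

lemma orbit_factor_has_prod:
  assumes "card Y > 0"
  shows "fps_has_prod (orbit_factor G \<alpha> Y y) {1..} (fps_exp 1 oo orbit_log G \<alpha> Y y)"
proof -
  define k where "k = card Y"
  define b where "b = b_coeff G (stabilizer G \<alpha> y)"
  define h where "h n = fps_const (- b n) * (fps_ln 1 oo (- (fps_X ^ (k * n))))" for n
  have k: "k > 0"
    using assms by (simp add: k_def)
  have h_nth: "fps_nth (h n) j =
      (if j > 0 \<and> k * n dvd j then b n * (of_nat (k * n) / of_nat j) else 0)" if "n \<ge> 1" for n j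
    using that k fps_ln_compose_uminus_X_power[of "k * n" j, where 'a = rat]
    by (simp add: h_def)
  \<comment> \<open>The logarithm of factor \<open>n\<close> reaches degree \<open>j\<close> only if
    \<open>k * n\<close> divides \<open>j\<close>, so finitely many factors matter in each
    degree.\<close>
  have supp: "{n \<in> {1..}. fps_nth (h n) j \<noteq> 0} \<subseteq>
      (if j > 0 \<and> k dvd j then {n. n dvd j div k} else {})" for j
    using k by (auto simp: h_nth split: if_splits elim!: dvdE)
  have fin: "finite (if j > 0 \<and> k dvd j then {n. n dvd j div k} else {})" for j
    using k by (auto elim!: dvdE)
  have "fps_has_prod (\<lambda>n. fps_exp 1 oo h n) {1..} (fps_exp 1 oo orbit_log G \<alpha> Y y)"
  proof (rule fps_has_prod_exp_compose)
    show "fps_nth (h n) 0 = 0" for n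
      by (simp add: h_def)
    show "finite {n \<in> {1..}. fps_nth (h n) j \<noteq> 0}" for j
      using supp fin by (rule finite_subset)
    show "fps_nth (orbit_log G \<alpha> Y y) j =
        (\<Sum>n | n \<in> {1..} \<and> fps_nth (h n) j \<noteq> 0. fps_nth (h n) j)" for j
    proof (cases "j > 0 \<and> k dvd j")
      case True
      then obtain m where m: "j = k * m" "m > 0"
        by (auto elim!: dvdE)
      \<comment> \<open>Divisors of \<open>m\<close> outside the support contribute 0, so the sum
        may run over all divisors.\<close>
      have "(\<Sum>n | n \<in> {1..} \<and> fps_nth (h n) j \<noteq> 0. fps_nth (h n) j) = (\<Sum>n | n dvd m. fps_nth (h n) j)"
        using supp[of j] k m by (intro sum.mono_neutral_left) (auto simp: Suc_le_eq dvd_pos_nat)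
      also have "\<dots> = (\<Sum>n | n dvd m. b n * (of_nat n / of_nat m))"
        using k m by (intro sum.cong) (auto simp: h_nth Suc_le_eq dvd_pos_nat)
      finally show ?thesis
        unfolding b_def b_coeff_def sum_group_Delta_mult[OF m(2)]
        using k m by (simp add: orbit_log_def flip: k_def)
    next
      case False
      then have "{n. n \<in> {1..} \<and> fps_nth (h n) j \<noteq> 0} = {}"
        using supp[of j] by auto
      moreover have "fps_nth (orbit_log G \<alpha> Y y) j = 0"
        using False by (auto simp: k_def orbit_log_def)
      ultimately show ?thesis
        by (simp only: sum.empty)
    qed
  qed
  then show ?thesis
    by (simp add: orbit_factor_def [abs_def] fps_one_minus_powr_def h_def k_def b_def)
qed

text \<open>Quantifying over all choices \<open>r\<close> of base points makes independence of the
  chosen stabilizers part of the claim. Convergence of the inner products is asserted separately,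
  since \<open>fps_prodinf\<close> denotes a product only when the limit exists.\<close>

theorem theorem1p1:
  fixes G :: "('a, 'c) monoid_scheme"
    and X :: "'x set"
    and \<alpha> :: "'a \<Rightarrow> 'x \<Rightarrow> 'x"
  assumes "group G"
    and "infinite (carrier G)"
    and "finitely_generated G"
    and "group_action G X \<alpha>"
    and "\<And>L. L \<in> finite_index_subgroups G \<Longrightarrow> finite (fixed_points X \<alpha> L)"
  shows "(\<forall>r. (\<forall>Y\<in>finite_orbits G X \<alpha>. r Y \<in> Y) \<longrightarrow>
            (\<forall>Y\<in>finite_orbits G X \<alpha>. fps_prodable (orbit_factor G \<alpha> Y (r Y)) {1..}) \<and>
            fps_has_prod (\<lambda>Y. fps_prodinf (orbit_factor G \<alpha> Y (r Y)) {1..})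
              (finite_orbits G X \<alpha>) (dynamical_zeta G X \<alpha>)) \<and>
         ((\<forall>L\<in>finite_index_subgroups G. \<forall>n\<ge>1. b_coeff G L n \<in> \<int>) \<longrightarrow>
            (\<forall>n. fps_nth (dynamical_zeta G X \<alpha>) n \<in> \<int>))"
proof -
  interpret group G by fact
  interpret group_action G X \<alpha> by fact
  let ?O = "finite_orbits G X \<alpha>"
  note fin = finite_subgroups_of_index[OF assms(3)]
  note finO = finite_orbits_card_dvd[OF fin assms(5)]
  have orbit: "Y \<in> orbits G X \<alpha>" "finite Y" "Y \<noteq> {}" "card Y > 0" if "Y \<in> ?O" for Y
    using that orbit_refl by (auto simp: finite_orbits_def orbits_def card_gt_0_iff)
  have prod: "fps_has_prod (orbit_factor G \<alpha> Y y) {1..} (fps_exp 1 oo orbit_log G \<alpha> Y y)"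
    if "Y \<in> ?O" for Y y
    using orbit(4)[OF that] by (rule orbit_factor_has_prod)
  have prodinf: "fps_prodinf (orbit_factor G \<alpha> Y y) {1..} = fps_exp 1 oo orbit_log G \<alpha> Y y"
    if "Y \<in> ?O" for Y y
    by (rule fps_prodinf_eqI[OF prod[OF that]])
  have zeta: "fps_has_prod (\<lambda>Y. fps_exp 1 oo orbit_log G \<alpha> Y (r Y)) ?O (dynamical_zeta G X \<alpha>)"
    if r: "\<And>Y. Y \<in> ?O \<Longrightarrow> r Y \<in> Y" for r
    unfolding dynamical_zeta_def
  proof (rule fps_has_prod_exp_compose)
    have supp: "{Y \<in> ?O. fps_nth (orbit_log G \<alpha> Y (r Y)) n \<noteq> 0} \<subseteq> {Y \<in> ?O. card Y dvd n}" for n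
      by (auto simp: orbit_log_def)
    show "fps_nth (orbit_log G \<alpha> Y (r Y)) 0 = 0" for Y
      by (simp add: orbit_log_def)
    \<comment> \<open>Every orbit size divides 0, so \<open>finO\<close> covers only positive
      \<open>n\<close>; for \<open>n = 0\<close> all constant terms vanish and the support is
      empty.\<close>
    show "finite {Y \<in> ?O. fps_nth (orbit_log G \<alpha> Y (r Y)) n \<noteq> 0}" for n
      using finite_subset[OF supp finO, of n] by (cases "n = 0") (simp_all add: orbit_log_def)
    show "fps_nth (Abs_fps (\<lambda>n. if n = 0 then 0 else
          1 / of_nat n * (\<Sum>L\<in>subgroups_of_index G n. of_nat (card (fixed_points X \<alpha> L))))) n =
        (\<Sum>Y | Y \<in> ?O \<and> fps_nth (orbit_log G \<alpha> Y (r Y)) n \<noteq> 0. fps_nth (orbit_log G \<alpha> Y (r Y)) n)" for n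
    proof (cases "n = 0")
      case True
      then show ?thesis by (simp add: orbit_log_def)
    next
      case False
      then have n: "n > 0" by simp
      have "(\<Sum>L\<in>subgroups_of_index G n. of_nat (card (fixed_points X \<alpha> L)) :: rat) =
          of_nat (\<Sum>L\<in>subgroups_of_index G n. card (fixed_points X \<alpha> L))"
        by simp
      also have "\<dots> = (\<Sum>Y | Y \<in> ?O \<and> card Y dvd n. of_nat (card Y) *
          of_nat (card (subgroups_of_index (G\<lparr>carrier := stabilizer G \<alpha> (r Y)\<rparr>) (n div card Y))))"
        by (subst sum_card_fixed_points[OF fin assms(5) r n]) simp_all
      finally have "1 / of_nat n * (\<Sum>L\<in>subgroups_of_index G n. of_nat (card (fixed_points X \<alpha> L))) =
          (\<Sum>Y | Y \<in> ?O \<and> card Y dvd n. 1 / of_nat n * (of_nat (card Y) *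
            of_nat (card (subgroups_of_index (G\<lparr>carrier := stabilizer G \<alpha> (r Y)\<rparr>) (n div card Y)))) :: rat)"
        by (simp only: sum_distrib_left)
      \<comment> \<open>Writing n = |Y| m, the factor |Y| / n becomes the 1 / m of
        \<open>orbit_log\<close>.\<close>
      also have "\<dots> = (\<Sum>Y | Y \<in> ?O \<and> card Y dvd n. fps_nth (orbit_log G \<alpha> Y (r Y)) n)"
      proof (rule sum.cong[OF refl])
        fix Y assume "Y \<in> {Y \<in> ?O. card Y dvd n}"
        moreover from this have "card Y > 0"
          using orbit(4) by blast
        ultimately show "1 / of_nat n * (of_nat (card Y) *
              of_nat (card (subgroups_of_index (G\<lparr>carrier := stabilizer G \<alpha> (r Y)\<rparr>) (n div card Y)))) =
            fps_nth (orbit_log G \<alpha> Y (r Y)) n"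
          using n by (auto simp: orbit_log_def elim!: dvdE)
      qed
      also have "\<dots> = (\<Sum>Y | Y \<in> ?O \<and> fps_nth (orbit_log G \<alpha> Y (r Y)) n \<noteq> 0.
          fps_nth (orbit_log G \<alpha> Y (r Y)) n)"
        using supp by (intro sum.mono_neutral_right finO n) auto
      finally show ?thesis
        using n by simp
    qed
  qed
  show ?thesis
  proof (intro conjI allI impI ballI)
    fix r :: "'x set \<Rightarrow> 'x" and Y
    assume "Y \<in> ?O"
    then show "fps_prodable (orbit_factor G \<alpha> Y (r Y)) {1..}"
      using prod by (auto simp: fps_prodable_def)
  next
    fix r :: "'x set \<Rightarrow> 'x"
    assume "\<forall>Y\<in>?O. r Y \<in> Y"
    then have "fps_has_prod (\<lambda>Y. fps_exp 1 oo orbit_log G \<alpha> Y (r Y)) ?O (dynamical_zeta G X \<alpha>)"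
      using zeta by blast
    then show "fps_has_prod (\<lambda>Y. fps_prodinf (orbit_factor G \<alpha> Y (r Y)) {1..}) ?O (dynamical_zeta G X \<alpha>)"
      by (rule fps_has_prod_cong[THEN iffD2, rotated]) (simp only: prodinf)
  next
    fix n
    assume int: "\<forall>L\<in>finite_index_subgroups G. \<forall>n\<ge>1. b_coeff G L n \<in> \<int>"
    \<comment> \<open>Any choice of base points serves, because the product formula holds for all of
      them. Integrality then passes to the limit twice, first within each orbit and then over the
      orbits.\<close>
    define r where "r Y = (SOME y. y \<in> Y)" for Y :: "'x set"
    have r: "r Y \<in> Y" if "Y \<in> ?O" for Y
      using orbit(3)[OF that] by (simp add: r_def some_in_eq)
    have "fps_int_coeffs (fps_exp 1 oo orbit_log G \<alpha> Y (r Y))" if Y: "Y \<in> ?O" for Y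
    proof (rule fps_int_coeffs_has_prod[OF prod[OF Y]])
      fix m :: nat assume m: "m \<in> {1..}"
      have "stabilizer G \<alpha> (r Y) \<in> finite_index_subgroups G"
        using orbit_eq[OF orbit(1)[OF Y] r[OF Y]] orbit(2)[OF Y]
        by (intro stabilizer_in_finite_index_subgroups) simp_all
      then show "fps_int_coeffs (orbit_factor G \<alpha> Y (r Y) m)"
        using int m orbit(4)[OF Y] unfolding orbit_factor_def
        by (intro fps_int_coeffs_one_minus_powr) simp_all
    qed
    then have "fps_int_coeffs (dynamical_zeta G X \<alpha>)"
      using fps_int_coeffs_has_prod[OF zeta[of r]] r by blast
    then show "fps_nth (dynamical_zeta G X \<alpha>) n \<in> \<int>"
      by (simp add: fps_int_coeffs_def)
  qed
qed

end
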